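(* Let $I$ and $J$ be disjoint non-degenerate intervals contained in $[0,1]$ and let $f,g:[0,1]\to\mathbb{R}$ be such that there is $x_0\in[0,1/2]$ with $f(x_0)=g(x_0)$, and $\lambda(I)+\lambda(J)<1$, where $\lambda$ is Lebesgue measure. If $Q$ is a basic sequence that is infinite in limit, then $$\dim_H\Big\{x\in[0,1):\ f\Big(\lim_{n\to\infty}\frac{A_n(I,\mathcal{O}_Q(x))}{n}\Big)=g\Big(\lim_{n\to\infty}\frac{A_n(J,\mathcal{O}_Q(x))}{n}\Big)\Big\}=1.$$
   Context: A basic sequence is $Q=(q_n)_{n\ge1}$ with integers $q_n\ge2$; infinite in limit means $q_n\to\infty$. $T_{Q,n}(x)=q_n\cdots q_1x\bmod1$ and $\mathcal{O}_Q(x)=(T_{Q,n}(x))_{n\ge0}$. For a sequence $\omega=(x_i)$ and an interval $I$, $A_n(I,\omega)=\#\{i\le n:x_i\in I\}$. The set consists of those $x$ for which both limits exist and the equality holds. *)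

theory Defs
  imports "HOL-Analysis.Analysis"
begin

text \<open>
  The contribution \<open>|U|\<^sup>s\<close> of a covering set, with the conventions that the empty set
  contributes \<open>0\<close> for every \<open>s\<close>, and a nonempty set contributes \<open>1\<close> for \<open>s = 0\<close>. The case
  \<open>s = 0\<close> has to be singled out because \<open>0 powr 0 = 0\<close>.
\<close>

definition hausdorff_gauge :: "real \<Rightarrow> 'a::metric_space set \<Rightarrow> ennreal" where
  "hausdorff_gauge s U =
     (if U = {} then 0 else if s = 0 then 1 else ennreal (diameter U powr s))"

text \<open>
  Boundedness is required explicitly because \<open>diameter\<close> is real-valued and carries no information
  on unbounded sets. Finite covers are included by padding with the empty set.
\<close>

definition delta_covers :: "real \<Rightarrow> 'a::metric_space set \<Rightarrow> (nat \<Rightarrow> 'a set) set" where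
  "delta_covers \<delta> A =
     {U. A \<subseteq> (\<Union>i. U i) \<and> (\<forall>i. bounded (U i) \<and> diameter (U i) \<le> \<delta>)}"

definition hausdorff_pre_measure :: "real \<Rightarrow> real \<Rightarrow> 'a::metric_space set \<Rightarrow> ennreal" where
  "hausdorff_pre_measure s \<delta> A = (INF U\<in>delta_covers \<delta> A. \<Sum>i. hausdorff_gauge s (U i))"

definition hausdorff_measure :: "real \<Rightarrow> 'a::metric_space set \<Rightarrow> ennreal" where
  "hausdorff_measure s A = (SUP \<delta>\<in>{0<..}. hausdorff_pre_measure s \<delta> A)"

definition hausdorff_dim :: "'a::metric_space set \<Rightarrow> ennreal" where
  "hausdorff_dim A = (INF s\<in>{s. 0 \<le> s \<and> hausdorff_measure s A = 0}. ennreal s)"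

text \<open>Basic sequences are indexed from \<open>1\<close>; the value at \<open>0\<close> is irrelevant.\<close>

definition basic_sequence :: "(nat \<Rightarrow> nat) \<Rightarrow> bool" where
  "basic_sequence q \<longleftrightarrow> (\<forall>n\<ge>1. 2 \<le> q n)"

definition infinite_in_limit :: "(nat \<Rightarrow> nat) \<Rightarrow> bool" where
  "infinite_in_limit q \<longleftrightarrow> filterlim q at_top sequentially"

definition cantor_T :: "(nat \<Rightarrow> nat) \<Rightarrow> nat \<Rightarrow> real \<Rightarrow> real" where
  "cantor_T q n x = frac (real (\<Prod>i=1..n. q i) * x)"

definition cantor_orbit :: "(nat \<Rightarrow> nat) \<Rightarrow> real \<Rightarrow> nat \<Rightarrow> real" where
  "cantor_orbit q x = (\<lambda>n. cantor_T q n x)"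

definition visits :: "nat \<Rightarrow> real set \<Rightarrow> (nat \<Rightarrow> real) \<Rightarrow> nat" where
  "visits n I \<omega> = card {i. i \<le> n \<and> \<omega> i \<in> I}"

definition nondegenerate_interval :: "real set \<Rightarrow> bool" where
  "nondegenerate_interval I \<longleftrightarrow> is_interval I \<and> (\<exists>a\<in>I. \<exists>b\<in>I. a < b)"

end

theory Submission
  imports Defs
begin

text \<open>
  Fix \<open>p \<le> 1/2\<close> with \<open>f p = g p\<close>. The times \<open>n\<close> at which \<open>(n p, (n + 1) p]\<close> contains an integer,
  respectively a half-integer, form disjoint sets of density \<open>p\<close>. Force the orbit of \<open>x\<close> into a
  compact part of \<open>I\<close> at times of the first kind, of \<open>J\<close> at times of the second kind, and of the
  complement of \<open>I \<union> J\<close> otherwise; compactness keeps the orbit away from \<open>0\<close> and \<open>1\<close>, which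
  separates points of neighbouring cylinders. From some time on, each constraint leaves a block of
  \<open>m\<^sub>n \<ge> c q\<^sub>n\<close> consecutive digits. Since \<open>q\<^sub>n \<rightarrow> \<infinity>\<close>, the product of the \<open>m\<^sub>n\<close> dominates every power
  \<open>s < 1\<close> of the product of the \<open>q\<^sub>n\<close>, so reading the digits of such \<open>x\<close> in base \<open>m\<close> is an
  \<open>s\<close>-Hoelder map onto \<open>[0,1)\<close>, whence the constrained set has positive \<open>s\<close>-dimensional measure.
\<close>

section \<open>Hausdorff measure and dimension\<close>

lemma diameter_le_dist:
  fixes S :: "'a::metric_space set"
  assumes "S \<noteq> {} \<or> 0 \<le> d" "\<And>x y. x \<in> S \<Longrightarrow> y \<in> S \<Longrightarrow> dist x y \<le> d"
  shows "diameter S \<le> d"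
  using assms by (auto simp: diameter_def intro!: cSUP_least)

lemma hausdorff_pre_measure_antimono:
  assumes "\<delta> \<le> \<epsilon>"
  shows "hausdorff_pre_measure s \<epsilon> A \<le> hausdorff_pre_measure s \<delta> A"
  unfolding hausdorff_pre_measure_def using assms
  by (intro INF_superset_mono) (auto simp: delta_covers_def intro: order_trans)

lemma hausdorff_pre_measure_le_hausdorff_measure:
  "0 < \<delta> \<Longrightarrow> hausdorff_pre_measure s \<delta> A \<le> hausdorff_measure s A"
  unfolding hausdorff_measure_def by (rule SUP_upper) simp

lemma hausdorff_measure_mono:
  assumes "A \<subseteq> B"
  shows "hausdorff_measure s A \<le> hausdorff_measure s B"
  unfolding hausdorff_measure_def hausdorff_pre_measure_def using assms
  by (intro SUP_mono' INF_superset_mono) (auto simp: delta_covers_def)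

lemma hausdorff_dim_mono:
  assumes "A \<subseteq> B"
  shows "hausdorff_dim A \<le> hausdorff_dim B"
  unfolding hausdorff_dim_def
proof (intro INF_superset_mono subsetI)
  show "s \<in> {s. 0 \<le> s \<and> hausdorff_measure s A = 0}"
    if "s \<in> {s. 0 \<le> s \<and> hausdorff_measure s B = 0}" for s
    using that hausdorff_measure_mono[OF assms, of s] by simp
qed simp

lemma hausdorff_pre_measure_transfer:
  assumes "0 < c"
    and transfer: "\<And>U. U \<in> delta_covers \<delta> A \<Longrightarrow>
      \<exists>V\<in>delta_covers \<epsilon> B. \<forall>i. hausdorff_gauge t (V i) \<le> ennreal c * hausdorff_gauge s (U i)"
  shows "hausdorff_pre_measure t \<epsilon> B \<le> ennreal c * hausdorff_pre_measure s \<delta> A"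
proof -
  have "hausdorff_pre_measure t \<epsilon> B \<le> ennreal c * (\<Sum>i. hausdorff_gauge s (U i))"
    if U: "U \<in> delta_covers \<delta> A" for U
  proof -
    obtain V where V: "V \<in> delta_covers \<epsilon> B"
      "\<And>i. hausdorff_gauge t (V i) \<le> ennreal c * hausdorff_gauge s (U i)"
      using transfer[OF U] by blast
    have "hausdorff_pre_measure t \<epsilon> B \<le> (\<Sum>i. hausdorff_gauge t (V i))"
      unfolding hausdorff_pre_measure_def using V(1) by (rule INF_lower)
    also have "\<dots> \<le> (\<Sum>i. ennreal c * hausdorff_gauge s (U i))"
      using V(2) by (intro suminf_le) auto
    finally show ?thesis by simp
  qed
  then have scaled_le: "hausdorff_pre_measure t \<epsilon> B / ennreal c \<le> hausdorff_pre_measure s \<delta> A"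
    unfolding hausdorff_pre_measure_def[of s] using \<open>0 < c\<close>
    by (intro INF_greatest divide_le_posI_ennreal) auto
  have "hausdorff_pre_measure t \<epsilon> B = ennreal c * (hausdorff_pre_measure t \<epsilon> B / ennreal c)"
    using \<open>0 < c\<close>
    by (simp add: ennreal_times_divide mult.commute[of "ennreal c"] ennreal_mult_divide_eq)
  also have "\<dots> \<le> ennreal c * hausdorff_pre_measure s \<delta> A"
    using scaled_le by (rule mult_left_mono) simp
  finally show ?thesis .
qed

lemma hausdorff_gauge_le_powr_mult:
  assumes st: "0 \<le> s" "s < t" and U: "bounded U" "diameter U \<le> \<delta>"
  shows "hausdorff_gauge t U \<le> ennreal (\<delta> powr (t - s)) * hausdorff_gauge s U"
proof (cases "U = {}")
  case False
  have "0 \<le> diameter U" using U(1) by (rule diameter_ge_0)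
  then have powr_le: "diameter U powr (t - s) \<le> \<delta> powr (t - s)"
    using U(2) st by (intro powr_mono2) auto
  then have "diameter U powr (t - s) * diameter U powr s \<le> \<delta> powr (t - s) * diameter U powr s"
    by (rule mult_right_mono) simp
  then show ?thesis
    using False st powr_le
    by (auto simp: hausdorff_gauge_def ennreal_mult[symmetric] powr_add[symmetric]
        intro!: ennreal_leI)
qed (simp add: hausdorff_gauge_def)

lemma hausdorff_measure_eq_0_of_less:
  assumes st: "0 \<le> s" "s < t" and finite: "hausdorff_measure s A < \<infinity>"
  shows "hausdorff_measure t A = 0"
proof -
  have "hausdorff_pre_measure t \<delta> A \<le> 0" if "0 < \<delta>" for \<delta>
  proof (rule tendsto_lowerbound)
    have "((\<lambda>\<epsilon>. \<epsilon> powr (t - s)) \<longlongrightarrow> 0 powr (t - s)) (at_right 0)"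
      using st by (intro tendsto_powr2 tendsto_intros) (auto simp: eventually_at_filter)
    then have "((\<lambda>\<epsilon>. ennreal (\<epsilon> powr (t - s))) \<longlongrightarrow> ennreal 0) (at_right 0)"
      using st by (intro tendsto_ennrealI) simp
    then have "((\<lambda>\<epsilon>. ennreal (\<epsilon> powr (t - s)) * hausdorff_measure s A) \<longlongrightarrow>
        ennreal 0 * hausdorff_measure s A) (at_right 0)"
      using finite by (intro tendsto_mult_ennreal tendsto_const) auto
    then show "((\<lambda>\<epsilon>. ennreal (\<epsilon> powr (t - s)) * hausdorff_measure s A) \<longlongrightarrow> 0) (at_right 0)"
      by simp
    have "hausdorff_pre_measure t \<delta> A \<le> ennreal (\<epsilon> powr (t - s)) * hausdorff_measure s A"
      if "0 < \<epsilon>" "\<epsilon> \<le> \<delta>" for \<epsilon>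
    proof -
      have "hausdorff_pre_measure t \<delta> A \<le> hausdorff_pre_measure t \<epsilon> A"
        using that(2) by (rule hausdorff_pre_measure_antimono)
      also have "\<dots> \<le> ennreal (\<epsilon> powr (t - s)) * hausdorff_pre_measure s \<epsilon> A"
      proof (rule hausdorff_pre_measure_transfer)
        fix U assume "U \<in> delta_covers \<epsilon> A"
        then show "\<exists>V\<in>delta_covers \<epsilon> A. \<forall>i.
            hausdorff_gauge t (V i) \<le> ennreal (\<epsilon> powr (t - s)) * hausdorff_gauge s (U i)"
          by (intro bexI[of _ U] allI hausdorff_gauge_le_powr_mult[OF st])
            (auto simp: delta_covers_def)
      qed (use that in simp)
      also have "\<dots> \<le> ennreal (\<epsilon> powr (t - s)) * hausdorff_measure s A"
        using that(1) by (intro mult_left_mono hausdorff_pre_measure_le_hausdorff_measure) auto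
      finally show ?thesis .
    qed
    then show "\<forall>\<^sub>F \<epsilon> in at_right 0.
        hausdorff_pre_measure t \<delta> A \<le> ennreal (\<epsilon> powr (t - s)) * hausdorff_measure s A"
      using eventually_at_right_real[OF \<open>0 < \<delta>\<close>] by (auto elim!: eventually_mono)
  qed simp
  then show ?thesis
    unfolding hausdorff_measure_def by (intro antisym SUP_least) auto
qed

lemma le_hausdorff_dimI:
  assumes "0 < t" "\<And>s. 0 < s \<Longrightarrow> s < t \<Longrightarrow> hausdorff_measure s A \<noteq> 0"
  shows "ennreal t \<le> hausdorff_dim A"
  unfolding hausdorff_dim_def
proof (rule INF_greatest)
  fix s assume s: "s \<in> {s. 0 \<le> s \<and> hausdorff_measure s A = 0}"
  have "t \<le> s"
  proof (rule ccontr)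
    assume "\<not> t \<le> s"
    then have "hausdorff_measure ((s + t) / 2) A = 0"
      using s by (intro hausdorff_measure_eq_0_of_less[of s]) auto
    moreover have "hausdorff_measure ((s + t) / 2) A \<noteq> 0"
      using \<open>\<not> t \<le> s\<close> \<open>0 < t\<close> s by (intro assms(2)) auto
    ultimately show False by contradiction
  qed
  then show "ennreal t \<le> ennreal s" by (rule ennreal_leI)
qed

lemma hausdorff_dim_leI:
  assumes "0 \<le> s" "hausdorff_measure s A < \<infinity>"
  shows "hausdorff_dim A \<le> ennreal s"
proof (rule ennreal_le_epsilon)
  fix e :: real assume "0 < e"
  then have "hausdorff_dim A \<le> ennreal (s + e)"
    unfolding hausdorff_dim_def using assms hausdorff_measure_eq_0_of_less[of s "s + e" A]
    by (intro INF_lower) auto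
  then show "hausdorff_dim A \<le> ennreal s + ennreal e" using \<open>0 < e\<close> \<open>0 \<le> s\<close> by simp
qed

lemma
  fixes f :: "'c \<Rightarrow> 'a::metric_space" and g :: "'c \<Rightarrow> 'b::metric_space"
  assumes pos: "0 < C" "0 < \<alpha>" and U: "bounded U"
    and Hoelder: "\<And>x y. x \<in> S \<Longrightarrow> y \<in> S \<Longrightarrow> dist (f x) (f y) \<le> C * dist (g x) (g y) powr \<alpha>"
  shows bounded_Hoelder_image: "bounded (f ` (S \<inter> g -` U))"
    and diameter_Hoelder_image_le: "diameter (f ` (S \<inter> g -` U)) \<le> C * diameter U powr \<alpha>"
    and hausdorff_gauge_Hoelder_image_le: "0 < s \<Longrightarrow>
      hausdorff_gauge s (f ` (S \<inter> g -` U)) \<le> ennreal (C powr s) * hausdorff_gauge (\<alpha> * s) U"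
proof -
  let ?V = "f ` (S \<inter> g -` U)"
  have dist: "dist u v \<le> C * diameter U powr \<alpha>" if uv: "u \<in> ?V" "v \<in> ?V" for u v
  proof -
    obtain x y where xy: "x \<in> S" "y \<in> S" "g x \<in> U" "g y \<in> U" and "u = f x" "v = f y"
      using uv by auto
    then have "dist u v \<le> C * dist (g x) (g y) powr \<alpha>" using Hoelder by simp
    also have "\<dots> \<le> C * diameter U powr \<alpha>"
      using pos diameter_bounded_bound[OF U xy(3,4)] by (intro mult_left_mono powr_mono2) auto
    finally show ?thesis .
  qed
  then show bounded: "bounded ?V" unfolding bounded_two_points by blast
  show diameter: "diameter ?V \<le> C * diameter U powr \<alpha>"
    using dist pos(1) by (intro diameter_le_dist) auto
  show "hausdorff_gauge s ?V \<le> ennreal (C powr s) * hausdorff_gauge (\<alpha> * s) U" if "0 < s"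
  proof (cases "?V = {}")
    case False
    then have "U \<noteq> {}" by auto
    have "diameter ?V powr s \<le> (C * diameter U powr \<alpha>) powr s"
      using that diameter diameter_ge_0[OF bounded] by (intro powr_mono2) auto
    also have "\<dots> = C powr s * diameter U powr (\<alpha> * s)"
      using pos by (simp add: powr_mult powr_powr)
    finally show ?thesis
      using False \<open>U \<noteq> {}\<close> pos that
      by (simp add: hausdorff_gauge_def ennreal_mult[symmetric] ennreal_leI)
  qed (simp add: hausdorff_gauge_def)
qed

text \<open>Parametrising both sets by \<open>S\<close> covers Hoelder images (\<open>g = id\<close>) and expanding maps
  (\<open>f = id\<close>) at once.\<close>

lemma hausdorff_measure_le_of_Hoelder:
  fixes f :: "'c \<Rightarrow> 'a::metric_space" and g :: "'c \<Rightarrow> 'b::metric_space"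
  assumes pos: "0 < C" "0 < \<alpha>" "0 < s"
    and Hoelder: "\<And>x y. x \<in> S \<Longrightarrow> y \<in> S \<Longrightarrow> dist (f x) (f y) \<le> C * dist (g x) (g y) powr \<alpha>"
  shows "hausdorff_measure s (f ` S) \<le> ennreal (C powr s) * hausdorff_measure (\<alpha> * s) (g ` S)"
  unfolding hausdorff_measure_def[of s]
proof (rule SUP_least)
  fix \<epsilon> :: real assume "\<epsilon> \<in> {0<..}"
  define \<delta> where "\<delta> = (\<epsilon> / C) powr (1 / \<alpha>)"
  have \<delta>: "0 < \<delta>" "C * \<delta> powr \<alpha> = \<epsilon>"
    using pos \<open>\<epsilon> \<in> {0<..}\<close> by (simp_all add: \<delta>_def powr_powr)
  have "hausdorff_pre_measure s \<epsilon> (f ` S)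
      \<le> ennreal (C powr s) * hausdorff_pre_measure (\<alpha> * s) \<delta> (g ` S)"
  proof (rule hausdorff_pre_measure_transfer)
    fix U assume U: "U \<in> delta_covers \<delta> (g ` S)"
    define V where "V i = f ` (S \<inter> g -` U i)" for i
    have bounded: "bounded (U i)" for i using U by (simp add: delta_covers_def)
    note image = bounded_Hoelder_image[OF pos(1,2) bounded Hoelder]
      diameter_Hoelder_image_le[OF pos(1,2) bounded Hoelder]
      hausdorff_gauge_Hoelder_image_le[OF pos(1,2) bounded Hoelder pos(3)]
    have "diameter (V i) \<le> \<epsilon>" for i
    proof -
      have "diameter (V i) \<le> C * diameter (U i) powr \<alpha>" unfolding V_def by (rule image(2))
      also have "\<dots> \<le> C * \<delta> powr \<alpha>"
        using U pos diameter_ge_0[OF bounded]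
        by (intro mult_left_mono powr_mono2) (auto simp: delta_covers_def)
      finally show ?thesis unfolding \<delta>(2) .
    qed
    moreover have "f ` S \<subseteq> (\<Union>i. V i)" using U by (fastforce simp: delta_covers_def V_def)
    moreover have "bounded (V i)" for i unfolding V_def by (rule image(1))
    ultimately have "V \<in> delta_covers \<epsilon> (f ` S)" by (simp add: delta_covers_def)
    moreover have "hausdorff_gauge s (V i)
        \<le> ennreal (C powr s) * hausdorff_gauge (\<alpha> * s) (U i)" for i
      unfolding V_def by (rule image(3))
    ultimately show "\<exists>V\<in>delta_covers \<epsilon> (f ` S).
        \<forall>i. hausdorff_gauge s (V i) \<le> ennreal (C powr s) * hausdorff_gauge (\<alpha> * s) (U i)"
      by blast
  qed (use pos in simp)
  also have "\<dots> \<le> ennreal (C powr s) * hausdorff_measure (\<alpha> * s) (g ` S)"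
    using \<delta>(1) by (intro mult_left_mono hausdorff_pre_measure_le_hausdorff_measure) auto
  finally show "hausdorff_pre_measure s \<epsilon> (f ` S)
      \<le> ennreal (C powr s) * hausdorff_measure (\<alpha> * s) (g ` S)" .
qed

lemma bounded_subset_Icc_diameter:
  fixes U :: "real set"
  assumes "bounded U"
  shows "\<exists>a. U \<subseteq> {a..a + diameter U}"
proof
  have minus_diameter_le: "y - diameter U \<le> x" if "x \<in> U" "y \<in> U" for x y
    using diameter_bounded_bound[OF assms that] by (simp add: dist_real_def)
  show "U \<subseteq> {Inf U..Inf U + diameter U}"
  proof
    fix x assume x: "x \<in> U"
    then have "x - diameter U \<le> Inf U"
      using minus_diameter_le by (intro cInf_greatest) auto
    then show "x \<in> {Inf U..Inf U + diameter U}"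
      using x cInf_lower[OF x bounded_imp_bdd_below[OF assms]] by auto
  qed
qed

lemma emeasure_lborel_le_hausdorff_measure:
  fixes A :: "real set"
  shows "emeasure lborel A \<le> hausdorff_measure 1 A"
proof -
  have "emeasure lborel A \<le> (\<Sum>i. hausdorff_gauge 1 (U i))" if U: "U \<in> delta_covers 1 A" for U
  proof -
    have "\<forall>i. \<exists>a. U i \<subseteq> {a..a + diameter (U i)}"
      using U by (simp add: delta_covers_def bounded_subset_Icc_diameter)
    then obtain a where a: "\<And>i. U i \<subseteq> {a i..a i + diameter (U i)}" by metis
    define W where "W i = (if U i = {} then {} else {a i..a i + diameter (U i)})" for i
    have W: "W i \<in> sets borel" "U i \<subseteq> W i" for i using a[of i] by (auto simp: W_def)
    then have "A \<subseteq> (\<Union>i. W i)" using U by (fastforce simp: delta_covers_def)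
    then have "emeasure lborel A \<le> emeasure lborel (\<Union>i. W i)"
      using W(1) by (intro emeasure_mono) auto
    also have "\<dots> \<le> (\<Sum>i. emeasure lborel (W i))"
      using W(1) by (intro emeasure_subadditive_countably) auto
    also have "\<dots> = (\<Sum>i. hausdorff_gauge 1 (U i))"
      using U
      by (simp add: W_def hausdorff_gauge_def delta_covers_def diameter_ge_0 if_distrib
          cong: if_cong)
    finally show ?thesis .
  qed
  then have "emeasure lborel A \<le> hausdorff_pre_measure 1 1 A"
    unfolding hausdorff_pre_measure_def by (rule INF_greatest)
  also have "\<dots> \<le> hausdorff_measure 1 A"
    by (rule hausdorff_pre_measure_le_hausdorff_measure) simp
  finally show ?thesis .
qed

lemma hausdorff_measure_unit_interval_le_1: "hausdorff_measure 1 {0..<1::real} \<le> 1"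
  unfolding hausdorff_measure_def
proof (rule SUP_least)
  fix \<delta> :: real assume "\<delta> \<in> {0<..}"
  then obtain n :: nat where n: "0 < n" "1 / real n < \<delta>"
    using real_arch_inverse[of \<delta>] by (auto simp: inverse_eq_divide)
  define U where "U i = (if i < n then {real i / real n..(real i + 1) / real n} else {})" for i
  have "real i / real n \<le> (real i + 1) / real n" for i by (simp add: divide_right_mono)
  then have diameter_U: "diameter (U i) = 1 / real n" "U i \<noteq> {}" if "i < n" for i
    using that by (simp_all add: U_def diff_divide_distrib[symmetric] not_less[symmetric])
  have "{0..<1} \<subseteq> (\<Union>i. U i)"
  proof
    fix x :: real assume x: "x \<in> {0..<1}"
    define i where "i = nat \<lfloor>real n * x\<rfloor>"
    have "real i \<le> real n * x" "real n * x < real i + 1" using x unfolding i_def by auto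
    moreover have "real n * x < real n" using x n by simp
    ultimately have "i < n" "x \<in> {real i / real n..(real i + 1) / real n}"
      using n by (linarith, simp add: field_simps)
    then show "x \<in> (\<Union>i. U i)" by (auto simp: U_def)
  qed
  moreover have "bounded (U i) \<and> diameter (U i) \<le> \<delta>" for i
    using diameter_U(1)[of i] n \<open>\<delta> \<in> _\<close> by (cases "i < n") (auto simp: U_def)
  ultimately have "U \<in> delta_covers \<delta> {0..<1}" by (auto simp: delta_covers_def)
  then have "hausdorff_pre_measure 1 \<delta> {0..<1::real} \<le> (\<Sum>i. hausdorff_gauge 1 (U i))"
    unfolding hausdorff_pre_measure_def by (rule INF_lower)
  also have "\<dots> = (\<Sum>i<n. hausdorff_gauge 1 (U i))"
    by (rule suminf_finite) (auto simp: U_def hausdorff_gauge_def)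
  also have "\<dots> = (\<Sum>i<n. ennreal (1 / real n))"
    using n by (intro sum.cong) (auto simp: hausdorff_gauge_def diameter_U)
  also have "\<dots> = 1"
    using n by (simp add: ennreal_of_nat_eq_real_of_nat ennreal_mult[symmetric])
  finally show "hausdorff_pre_measure 1 \<delta> {0..<1::real} \<le> 1" .
qed

lemma hausdorff_dim_subset_unit_interval_le_1:
  fixes A :: "real set"
  assumes "A \<subseteq> {0..<1}"
  shows "hausdorff_dim A \<le> 1"
proof -
  have "hausdorff_measure 1 A \<le> 1"
    using hausdorff_measure_mono[OF assms] hausdorff_measure_unit_interval_le_1
    by (rule order_trans)
  then have "hausdorff_measure 1 A < \<infinity>" by (rule le_less_trans) simp
  then show ?thesis using hausdorff_dim_leI[of 1] by simp
qed

section \<open>Cantor series\<close>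

definition digit_sequences :: "(nat \<Rightarrow> nat) \<Rightarrow> (nat \<Rightarrow> nat) set" where
  "digit_sequences b = {D. \<forall>n. D n < b n}"

definition cantor_tail :: "(nat \<Rightarrow> nat) \<Rightarrow> (nat \<Rightarrow> nat) \<Rightarrow> nat \<Rightarrow> real" where
  "cantor_tail b D n = (\<Sum>i. real (D (n + i)) / (\<Prod>l\<le>i. real (b (n + l))))"

lemma digit_sequences_less: "D \<in> digit_sequences b \<Longrightarrow> D n < b n"
  by (simp add: digit_sequences_def)

lemma digit_sequences_base_pos: "D \<in> digit_sequences b \<Longrightarrow> 0 < b n"
  using digit_sequences_less[of D b n] by simp

lemma digit_sequences_shift:
  "D \<in> digit_sequences b \<Longrightarrow> (\<lambda>i. D (n + i)) \<in> digit_sequences (\<lambda>i. b (n + i))"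
  by (simp add: digit_sequences_def)

lemma cantor_partial_sum_le:
  assumes D: "D \<in> digit_sequences b"
  shows "(\<Sum>i<k. real (D i) / (\<Prod>l\<le>i. real (b l))) \<le> 1 - 1 / (\<Prod>l<k. real (b l))"
proof (induction k)
  case (Suc k)
  define P where "P = (\<Prod>l<k. real (b l))"
  have P: "P > 0" unfolding P_def using digit_sequences_base_pos[OF D] by (intro prod_pos) simp
  have "real (D k) \<le> real (b k) - 1" using digit_sequences_less[OF D, of k] by linarith
  then have "real (D k) / (P * real (b k)) \<le> (real (b k) - 1) / (P * real (b k))"
    using P by (intro divide_right_mono) auto
  also have "\<dots> = 1 / P - 1 / (P * real (b k))"
    using P digit_sequences_base_pos[OF D, of k] by (simp add: field_simps)
  finally show ?case using Suc by (simp add: P_def lessThan_Suc_atMost[symmetric])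
qed simp

lemma
  assumes D: "D \<in> digit_sequences b"
  shows summable_cantor_tail: "summable (\<lambda>i. real (D (n + i)) / (\<Prod>l\<le>i. real (b (n + l))))"
    and cantor_tail_nonneg: "0 \<le> cantor_tail b D n"
    and cantor_tail_le_1: "cantor_tail b D n \<le> 1"
proof -
  let ?term = "\<lambda>i. real (D (n + i)) / (\<Prod>l\<le>i. real (b (n + l)))"
  have nonneg: "0 \<le> ?term i" for i by (intro divide_nonneg_nonneg prod_nonneg) auto
  have "0 \<le> 1 / (\<Prod>l<k. real (b (n + l)))" for k
    by (intro divide_nonneg_nonneg prod_nonneg) auto
  then have le_1: "sum ?term {..<k} \<le> 1" for k
    using cantor_partial_sum_le[OF digit_sequences_shift[OF D, of n], of k]
    by (smt (verit))
  show summable: "summable ?term" by (rule summableI_nonneg_bounded[OF nonneg le_1])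
  show "0 \<le> cantor_tail b D n"
    unfolding cantor_tail_def by (rule suminf_nonneg[OF summable nonneg])
  show "cantor_tail b D n \<le> 1"
    unfolding cantor_tail_def by (rule suminf_le_const[OF summable le_1])
qed

lemma cantor_tail_rec:
  assumes D: "D \<in> digit_sequences b"
  shows "cantor_tail b D n = (real (D n) + cantor_tail b D (Suc n)) / real (b n)"
proof -
  let ?term = "\<lambda>n i. real (D (n + i)) / (\<Prod>l\<le>i. real (b (n + l)))"
  have "cantor_tail b D n = (\<Sum>i. ?term n (Suc i)) + ?term n 0"
    unfolding cantor_tail_def using suminf_split_head[OF summable_cantor_tail[OF D, of n]] by simp
  also have "?term n (Suc i) = ?term (Suc n) i / real (b n)" for i
    unfolding prod.atMost_Suc_shift by simp
  then have "(\<Sum>i. ?term n (Suc i)) = cantor_tail b D (Suc n) / real (b n)"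
    unfolding cantor_tail_def by (simp only: suminf_divide[OF summable_cantor_tail[OF D]])
  finally show ?thesis by (simp add: add_divide_distrib)
qed

lemma cantor_tail_bounds:
  assumes D: "D \<in> digit_sequences b"
  shows "cantor_tail b D n \<in> {real (D n) / real (b n)..(real (D n) + 1) / real (b n)}"
  unfolding cantor_tail_rec[OF D, of n]
  using cantor_tail_nonneg[OF D, of "Suc n"] cantor_tail_le_1[OF D, of "Suc n"]
  by (auto intro!: divide_right_mono)

lemma frac_prod_times_cantor_tail:
  assumes D: "D \<in> digit_sequences b" and less: "cantor_tail b D n < 1"
  shows "frac (real (\<Prod>i<n. b i) * cantor_tail b D 0) = cantor_tail b D n"
proof -
  have "real (\<Prod>i<n. b i) * cantor_tail b D 0 - cantor_tail b D n \<in> \<int>"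
  proof (induction n)
    case (Suc n)
    let ?z = "real (\<Prod>i<n. b i) * cantor_tail b D 0 - cantor_tail b D n"
    have "real (\<Prod>i<Suc n. b i) * cantor_tail b D 0 - cantor_tail b D (Suc n)
        = real (b n) * ?z + real (D n)"
      using cantor_tail_rec[OF D, of n] digit_sequences_base_pos[OF D, of n]
      by (simp add: field_simps)
    also have "\<dots> \<in> \<int>" using Suc by simp
    finally show ?case .
  qed simp
  then show ?thesis using less cantor_tail_nonneg[OF D] by (simp add: frac_unique_iff)
qed

lemma expansion_diff_of_common_digits:
  fixes Z Z' :: "nat \<Rightarrow> real" and D D' b :: "nat \<Rightarrow> nat"
  assumes "\<And>n. Z n = (real (D n) + Z (Suc n)) / real (b n)"
    and "\<And>n. Z' n = (real (D' n) + Z' (Suc n)) / real (b n)"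
    and "\<And>n. n < k \<Longrightarrow> D n = D' n"
  shows "Z 0 - Z' 0 = (Z k - Z' k) / (\<Prod>i<k. real (b i))"
  using assms(3)
proof (induction k)
  case (Suc k)
  have "Z k - Z' k = (Z (Suc k) - Z' (Suc k)) / real (b k)"
    using assms(1)[of k] assms(2)[of k] Suc.prems[of k]
    by (simp add: diff_divide_distrib[symmetric])
  then show ?case using Suc by (simp add: mult.commute)
qed simp

lemma frac_of_nat_times_frac:
  fixes x :: "'a::floor_ceiling"
  shows "frac (of_nat n * frac x) = frac (of_nat n * x)"
proof -
  have "of_nat n * x = of_nat n * of_int \<lfloor>x\<rfloor> + of_nat n * frac x"
    by (simp add: frac_def algebra_simps)
  then show ?thesis by (simp add: frac_add_int_left)
qed

lemma cantor_expansion_exists: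
  assumes t: "t \<in> {0..<1}" and b: "\<And>n. 0 < b n"
    and vanishing: "(\<lambda>k. 1 / (\<Prod>i<k. real (b i))) \<longlonglongrightarrow> 0"
  obtains D where "D \<in> digit_sequences b" "cantor_tail b D 0 = t"
proof -
  define Z where "Z n = frac (real (\<Prod>i<n. b i) * t)" for n
  define D where "D n = nat \<lfloor>real (b n) * Z n\<rfloor>" for n
  have Z: "0 \<le> Z n" "Z n < 1" for n by (simp_all add: Z_def frac_lt_1)
  have D_floor: "real (D n) = of_int \<lfloor>real (b n) * Z n\<rfloor>" for n using Z(1) by (simp add: D_def)
  have "real (D n) < real (b n)" for n
  proof -
    have "real (D n) \<le> real (b n) * Z n" unfolding D_floor by simp
    also have "\<dots> < real (b n)" using Z(2)[of n] b[of n] by simp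
    finally show ?thesis .
  qed
  then have D: "D \<in> digit_sequences b" by (simp add: digit_sequences_def)
  have "Z (Suc n) = real (b n) * Z n - real (D n)" for n
    using frac_of_nat_times_frac[of "b n" "real (\<Prod>i<n. b i) * t"]
    by (simp add: Z_def[symmetric] D_floor frac_def[symmetric]) (simp add: Z_def mult_ac)
  then have Z_rec: "Z n = (real (D n) + Z (Suc n)) / real (b n)" for n using b[of n] by simp
  have bound: "\<bar>Z 0 - cantor_tail b D 0\<bar> \<le> 1 / (\<Prod>i<k. real (b i))" for k
  proof -
    have "Z 0 - cantor_tail b D 0 = (Z k - cantor_tail b D k) / (\<Prod>i<k. real (b i))"
      by (rule expansion_diff_of_common_digits[where Z = Z and Z' = "cantor_tail b D",
            OF Z_rec cantor_tail_rec[OF D]]) simp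
    moreover have "\<bar>Z k - cantor_tail b D k\<bar> \<le> 1"
      using Z[of k] cantor_tail_nonneg[OF D, of k] cantor_tail_le_1[OF D, of k] by simp
    moreover have "0 < (\<Prod>i<k. real (b i))" by (intro prod_pos) (simp add: b)
    ultimately show ?thesis by (simp add: abs_divide divide_right_mono del: abs_prod)
  qed
  have "\<bar>Z 0 - cantor_tail b D 0\<bar> \<le> 0" using vanishing bound by (intro LIMSEQ_le_const) auto
  moreover have "Z 0 = t" using t by (simp add: Z_def frac_eq)
  ultimately show ?thesis using D that by simp
qed

lemma cantor_tail_diff:
  assumes "D \<in> digit_sequences b" "D' \<in> digit_sequences b" and "\<And>n. n < k \<Longrightarrow> D n = D' n"
  shows "cantor_tail b D 0 - cantor_tail b D' 0
    = (real (D k) - real (D' k) + (cantor_tail b D (Suc k) - cantor_tail b D' (Suc k)))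
      / (\<Prod>i<Suc k. real (b i))"
proof -
  have "cantor_tail b D 0 - cantor_tail b D' 0
    = (cantor_tail b D k - cantor_tail b D' k) / (\<Prod>i<k. real (b i))"
    using assms(3)
    by (intro expansion_diff_of_common_digits[where Z = "cantor_tail b D"
          and Z' = "cantor_tail b D'",
          OF cantor_tail_rec[OF assms(1)] cantor_tail_rec[OF assms(2)]]) simp
  then show ?thesis
    unfolding cantor_tail_rec[OF assms(1), of k] cantor_tail_rec[OF assms(2), of k]
    by (simp add: diff_divide_distrib[symmetric] algebra_simps)
qed

lemma
  assumes D: "D \<in> digit_sequences b" "D' \<in> digit_sequences b"
    and k: "\<And>n. n < k \<Longrightarrow> D n = D' n" "D k \<noteq> D' k"
  shows cantor_tail_dist_le: "\<bar>cantor_tail b D 0 - cantor_tail b D' 0\<bar>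
      \<le> 2 * \<bar>real (D k) - real (D' k)\<bar> / (\<Prod>i<Suc k. real (b i))"
    and cantor_tail_dist_ge: "cantor_tail b D (Suc k) \<in> {\<delta>..1 - \<delta>} \<Longrightarrow>
      cantor_tail b D' (Suc k) \<in> {\<delta>..1 - \<delta>} \<Longrightarrow>
      2 * \<delta> * \<bar>real (D k) - real (D' k)\<bar> / (\<Prod>i<Suc k. real (b i))
        \<le> \<bar>cantor_tail b D 0 - cantor_tail b D' 0\<bar>"
proof -
  define j where "j = real (D k) - real (D' k)"
  let ?X = "cantor_tail b D (Suc k)" and ?X' = "cantor_tail b D' (Suc k)"
  define P where "P = (\<Prod>i<Suc k. real (b i))"
  have P: "0 < P" unfolding P_def using digit_sequences_base_pos[OF D(1)] by (intro prod_pos) simp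
  have j: "1 \<le> \<bar>j\<bar>" using k(2) unfolding j_def by linarith
  have dist: "\<bar>cantor_tail b D 0 - cantor_tail b D' 0\<bar> = \<bar>j + (?X - ?X')\<bar> / P"
    using cantor_tail_diff[OF D k(1)] P by (simp add: j_def P_def abs_divide del: prod.lessThan_Suc)
  have "\<bar>?X - ?X'\<bar> \<le> 1"
    using cantor_tail_nonneg[OF D(1)] cantor_tail_le_1[OF D(1)]
      cantor_tail_nonneg[OF D(2)] cantor_tail_le_1[OF D(2)] by (smt (verit))
  then have "\<bar>j + (?X - ?X')\<bar> \<le> 2 * \<bar>j\<bar>" using j by linarith
  then show "\<bar>cantor_tail b D 0 - cantor_tail b D' 0\<bar>
      \<le> 2 * \<bar>real (D k) - real (D' k)\<bar> / (\<Prod>i<Suc k. real (b i))"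
    using P unfolding dist P_def[symmetric] j_def[symmetric] by (intro divide_right_mono) auto
  show "2 * \<delta> * \<bar>real (D k) - real (D' k)\<bar> / (\<Prod>i<Suc k. real (b i))
      \<le> \<bar>cantor_tail b D 0 - cantor_tail b D' 0\<bar>"
    if X: "?X \<in> {\<delta>..1 - \<delta>}" "?X' \<in> {\<delta>..1 - \<delta>}"
  proof -
    have "1 - 2 * \<delta> \<le> (1 - 2 * \<delta>) * \<bar>j\<bar>"
      using X j mult_left_mono[of 1 "\<bar>j\<bar>" "1 - 2 * \<delta>"] by simp
    then have "2 * \<delta> * \<bar>j\<bar> \<le> \<bar>j\<bar> - (1 - 2 * \<delta>)" by (simp add: algebra_simps)
    also have "\<dots> \<le> \<bar>j + (?X - ?X')\<bar>" using X by auto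
    finally show ?thesis
      using P unfolding dist P_def[symmetric] j_def[symmetric] by (intro divide_right_mono) auto
  qed
qed

section \<open>Blocks of admissible digits\<close>

lemma summable_prod_of_tendsto_0:
  fixes f :: "nat \<Rightarrow> 'a::{real_normed_field, banach}"
  assumes "f \<longlonglongrightarrow> 0"
  shows "summable (\<lambda>k. \<Prod>i<k. f i)"
proof -
  have "\<forall>\<^sub>F k in sequentially. norm (f k) < 1 / 2"
    using tendsto_norm_zero[OF assms] by (rule order_tendstoD) simp
  then obtain N where N: "\<And>k. N \<le> k \<Longrightarrow> norm (f k) < 1 / 2"
    by (auto simp: eventually_sequentially)
  have "norm (\<Prod>i<Suc k. f i) \<le> 1 / 2 * norm (\<Prod>i<k. f i)" if "N \<le> k" for k
    using mult_right_mono[OF less_imp_le[OF N[OF that]], of "norm (\<Prod>i<k. f i)"]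
    by (simp add: norm_mult mult.commute)
  then show ?thesis by (intro summable_ratio_test[of "1 / 2" N]) auto
qed

text \<open>At place \<open>n\<close> the admissible digits in base \<open>r n\<close> are \<open>d n, \<dots>, d n + m n - 1\<close>.\<close>

locale digit_blocks =
  fixes r d m :: "nat \<Rightarrow> nat" and \<delta> c :: real
  assumes r_at_top: "filterlim r at_top sequentially"
    and r_pos: "0 < r n"
    and \<delta>_pos: "0 < \<delta>"
    and block_low: "\<delta> * real (r n) \<le> real (d n)"
    and block_high: "real (d n) + real (m n) \<le> (1 - \<delta>) * real (r n)"
    and c_pos: "0 < c"
    and block_density: "c * real (r n) \<le> real (m n)"
begin

definition shifted_tail :: "(nat \<Rightarrow> nat) \<Rightarrow> nat \<Rightarrow> real" where
  "shifted_tail D = cantor_tail r (\<lambda>n. d n + D n)"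

lemma m_pos: "0 < m n"
proof -
  have "0 < c * real (r n)" using c_pos r_pos by simp
  then show ?thesis using block_density[of n] by simp
qed

lemma shifted_digits:
  assumes "D \<in> digit_sequences m"
  shows "(\<lambda>n. d n + D n) \<in> digit_sequences r"
  unfolding digit_sequences_def
proof (intro CollectI allI)
  fix n
  have "real (d n) + real (m n) \<le> real (r n)"
    using block_high[of n] mult_left_mono[of "1 - \<delta>" 1 "real (r n)"] \<delta>_pos
    by (simp add: mult.commute)
  then show "d n + D n < r n" using digit_sequences_less[OF assms, of n] by linarith
qed

lemma shifted_tail_in_block:
  assumes "D \<in> digit_sequences m"
  shows "shifted_tail D n \<in> {real (d n) / real (r n)..(real (d n) + real (m n)) / real (r n)}"
proof -
  have "real (d n) / real (r n) \<le> real (d n + D n) / real (r n)"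
    by (intro divide_right_mono) auto
  moreover have "(real (d n + D n) + 1) / real (r n) \<le> (real (d n) + real (m n)) / real (r n)"
    using digit_sequences_less[OF assms, of n] by (intro divide_right_mono) auto
  ultimately show ?thesis
    using cantor_tail_bounds[OF shifted_digits[OF assms], of n] by (auto simp: shifted_tail_def)
qed

lemma shifted_tail_in_Icc:
  assumes "D \<in> digit_sequences m"
  shows "shifted_tail D n \<in> {\<delta>..1 - \<delta>}"
proof -
  have "\<delta> \<le> real (d n) / real (r n)" "(real (d n) + real (m n)) / real (r n) \<le> 1 - \<delta>"
    using block_low[of n] block_high[of n] r_pos[of n]
    by (simp_all add: pos_le_divide_eq pos_divide_le_eq)
  then show ?thesis using shifted_tail_in_block[OF assms, of n] by auto
qed

lemma r_powr_over_m_tendsto_0: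
  assumes "s < 1"
  shows "(\<lambda>n. real (r n) powr s / real (m n)) \<longlonglongrightarrow> 0"
proof (rule Lim_null_comparison)
  have "(\<lambda>n. real (r n) powr (s - 1)) \<longlonglongrightarrow> 0"
    using assms
    by (intro tendsto_neg_powr filterlim_compose[OF filterlim_real_sequentially r_at_top]) simp
  then show "(\<lambda>n. real (r n) powr (s - 1) / c) \<longlonglongrightarrow> 0" by (rule tendsto_divide_zero)
  show "\<forall>\<^sub>F n in sequentially.
      norm (real (r n) powr s / real (m n)) \<le> real (r n) powr (s - 1) / c"
  proof (intro always_eventually allI)
    fix n
    have "real (r n) powr s / real (m n) \<le> real (r n) powr s / (c * real (r n))"
      using block_density[of n] m_pos[of n] c_pos r_pos[of n] by (intro divide_left_mono) auto
    also have "\<dots> = real (r n) powr (s - 1) / c"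
      using r_pos[of n] by (simp add: powr_diff)
    finally show "norm (real (r n) powr s / real (m n)) \<le> real (r n) powr (s - 1) / c" by simp
  qed
qed

lemma inverse_prod_m_tendsto_0: "(\<lambda>k. 1 / (\<Prod>i<k. real (m i))) \<longlonglongrightarrow> 0"
proof -
  have "(\<lambda>n. 1 / real (m n)) \<longlonglongrightarrow> 0"
    using r_powr_over_m_tendsto_0[of 0] by (simp add: r_pos[THEN gr_implies_not0])
  then have "(\<lambda>k. \<Prod>i<k. 1 / real (m i)) \<longlonglongrightarrow> 0"
    by (rule summable_LIMSEQ_zero[OF summable_prod_of_tendsto_0])
  then show ?thesis by (simp only: prod_dividef prod.neutral_const)
qed

lemma prod_r_powr_le:
  assumes s: "0 < s" "s < 1"
  obtains C where "0 < C"
    "\<And>k. (\<Prod>i<Suc k. real (r i)) powr s \<le> C * ((\<Prod>i<k. real (m i)) * real (m k) powr s)"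
proof -
  define u where "u k = (\<Prod>i<k. real (r i) powr s / real (m i))" for k
  have "Bseq u" unfolding u_def
    by (intro summable_imp_Bseq summable_prod_of_tendsto_0 r_powr_over_m_tendsto_0 s)
  then obtain B where B: "0 < B" "\<And>k. \<bar>u k\<bar> \<le> B" by (auto elim: BseqE)
  have "(\<Prod>i<Suc k. real (r i)) powr s
      \<le> B / c powr s * ((\<Prod>i<k. real (m i)) * real (m k) powr s)" for k
  proof -
    have "(\<Prod>i<k. real (r i)) powr s = u k * (\<Prod>i<k. real (m i))"
      using m_pos by (simp add: u_def prod_powr_distrib prod.distrib[symmetric])
    then have "(\<Prod>i<Suc k. real (r i)) powr s = (u k * (\<Prod>i<k. real (m i))) * real (r k) powr s"
      by (simp add: powr_mult prod_nonneg)
    also have "\<dots> \<le> (B * (\<Prod>i<k. real (m i))) * (real (m k) / c) powr s"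
    proof (intro mult_mono powr_mono2)
      show "u k \<le> B" using B(2)[of k] by simp
      show "real (r k) \<le> real (m k) / c"
        using block_density[of k] c_pos by (simp add: field_simps)
    qed (use B(1) s in \<open>auto intro!: prod_nonneg mult_nonneg_nonneg\<close>)
    also have "\<dots> = B / c powr s * ((\<Prod>i<k. real (m i)) * real (m k) powr s)"
      using c_pos by (simp add: powr_divide)
    finally show ?thesis .
  qed
  then show ?thesis using B(1) c_pos by (intro that[of "B / c powr s"]) auto
qed

lemma cantor_tail_dist_le_shifted_tail_dist:
  assumes D: "D \<in> digit_sequences m" "D' \<in> digit_sequences m"
    and k: "\<And>n. n < k \<Longrightarrow> D n = D' n" "D k \<noteq> D' k"
    and s: "0 < s" "s < 1" and C: "0 < C"
      "(\<Prod>i<Suc k. real (r i)) powr s \<le> C * ((\<Prod>i<k. real (m i)) * real (m k) powr s)"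
  shows "\<bar>cantor_tail m D 0 - cantor_tail m D' 0\<bar>
    \<le> 2 * C / (2 * \<delta>) powr s * \<bar>shifted_tail D 0 - shifted_tail D' 0\<bar> powr s"
proof -
  define j where "j = \<bar>real (D k) - real (D' k)\<bar>"
  define P where "P = (\<Prod>i<Suc k. real (r i))"
  define M where "M = (\<Prod>i<k. real (m i))"
  have pos: "0 < P" "0 < M" "0 < real (m k)"
    unfolding P_def M_def by (intro prod_pos; simp add: r_pos m_pos)+ (simp add: m_pos)
  have j: "1 \<le> j" "j \<le> real (m k)"
    using k(2) digit_sequences_less[OF D(1), of k] digit_sequences_less[OF D(2), of k]
    unfolding j_def by linarith+
  have dist_ge: "2 * \<delta> * j / P \<le> \<bar>shifted_tail D 0 - shifted_tail D' 0\<bar>"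
    using cantor_tail_dist_ge[OF shifted_digits[OF D(1)] shifted_digits[OF D(2)], of k \<delta>]
      k shifted_tail_in_Icc[OF D(1)] shifted_tail_in_Icc[OF D(2)]
    by (simp add: shifted_tail_def j_def P_def del: prod.lessThan_Suc)
  have "\<bar>cantor_tail m D 0 - cantor_tail m D' 0\<bar> \<le> 2 * j / (M * real (m k))"
    using cantor_tail_dist_le[OF D k] by (simp add: j_def M_def)
  also have "2 * j / (M * real (m k)) = 2 * j powr s / M * (j powr (1 - s) / real (m k))"
    using j by (simp add: powr_diff)
  also have "\<dots> \<le> 2 * j powr s / M * (real (m k) powr (1 - s) / real (m k))"
    using j s pos by (intro mult_left_mono divide_right_mono powr_mono2) auto
  also have "\<dots> = 2 * j powr s * (1 / (M * real (m k) powr s))"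
    using pos by (simp add: powr_diff)
  also have "\<dots> \<le> 2 * j powr s * (C / P powr s)"
    using C(2) pos unfolding P_def[symmetric] M_def[symmetric]
    by (intro mult_left_mono) (auto simp: field_simps)
  also have "\<dots> = 2 * C / (2 * \<delta>) powr s * (2 * \<delta> * j / P) powr s"
    using \<delta>_pos j pos by (simp add: powr_mult powr_divide)
  also have "\<dots> \<le> 2 * C / (2 * \<delta>) powr s * \<bar>shifted_tail D 0 - shifted_tail D' 0\<bar> powr s"
    using dist_ge \<delta>_pos j pos s C(1) by (intro mult_left_mono powr_mono2) auto
  finally show ?thesis .
qed

lemma shifted_tail_expanding:
  assumes s: "0 < s" "s < 1"
  obtains C where "0 < C"
    "\<And>D D'. D \<in> digit_sequences m \<Longrightarrow> D' \<in> digit_sequences m \<Longrightarrow>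
      \<bar>cantor_tail m D 0 - cantor_tail m D' 0\<bar> \<le> C * \<bar>shifted_tail D 0 - shifted_tail D' 0\<bar> powr s"
proof -
  obtain C where C: "0 < C"
    "\<And>k. (\<Prod>i<Suc k. real (r i)) powr s \<le> C * ((\<Prod>i<k. real (m i)) * real (m k) powr s)"
    using prod_r_powr_le[OF s] by blast
  show ?thesis
  proof (rule that)
    show "0 < 2 * C / (2 * \<delta>) powr s" using C(1) \<delta>_pos by simp
    fix D D' assume D: "D \<in> digit_sequences m" "D' \<in> digit_sequences m"
    show "\<bar>cantor_tail m D 0 - cantor_tail m D' 0\<bar>
        \<le> 2 * C / (2 * \<delta>) powr s * \<bar>shifted_tail D 0 - shifted_tail D' 0\<bar> powr s"
    proof (cases "D = D'")
      case False
      then obtain k where "D k \<noteq> D' k" "\<And>n. n < k \<Longrightarrow> D n = D' n"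
        using exists_least_iff[of "\<lambda>n. D n \<noteq> D' n"] by auto
      then show ?thesis using cantor_tail_dist_le_shifted_tail_dist[OF D _ _ s C] by blast
    qed simp
  qed
qed

lemma hausdorff_measure_shifted_points_nonzero:
  assumes s: "0 < s" "s < 1"
  shows "hausdorff_measure s ((\<lambda>D. shifted_tail D 0) ` digit_sequences m) \<noteq> 0"
proof
  assume null: "hausdorff_measure s ((\<lambda>D. shifted_tail D 0) ` digit_sequences m) = 0"
  obtain C where C: "0 < C"
    "\<And>D D'. D \<in> digit_sequences m \<Longrightarrow> D' \<in> digit_sequences m \<Longrightarrow>
      \<bar>cantor_tail m D 0 - cantor_tail m D' 0\<bar> \<le> C * \<bar>shifted_tail D 0 - shifted_tail D' 0\<bar> powr s"
    using shifted_tail_expanding[OF s] by blast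
  have "{0..<1} \<subseteq> (\<lambda>D. cantor_tail m D 0) ` digit_sequences m"
  proof
    fix t :: real assume "t \<in> {0..<1}"
    then show "t \<in> (\<lambda>D. cantor_tail m D 0) ` digit_sequences m"
      using cantor_expansion_exists[OF _ m_pos inverse_prod_m_tendsto_0] by blast
  qed
  then have "hausdorff_measure 1 {0..<1::real}
      \<le> hausdorff_measure 1 ((\<lambda>D. cantor_tail m D 0) ` digit_sequences m)"
    by (rule hausdorff_measure_mono)
  also have "\<dots> \<le> ennreal (C powr 1) *
      hausdorff_measure (s * 1) ((\<lambda>D. shifted_tail D 0) ` digit_sequences m)"
    using C s by (intro hausdorff_measure_le_of_Hoelder) (auto simp: dist_real_def)
  finally have "hausdorff_measure 1 {0..<1::real} = 0" using null by simp
  then show False using emeasure_lborel_le_hausdorff_measure[of "{0..<1}"] by simp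
qed

end

section \<open>Orbits with prescribed targets\<close>

lemma prod_basic_sequence_pos:
  assumes "basic_sequence q"
  shows "0 < (\<Prod>i=1..N. q i)"
  using assms by (intro prod_pos) (force simp: basic_sequence_def)

lemma cantor_orbit_div_prod:
  assumes "basic_sequence q"
  shows "cantor_orbit q (x / real (\<Prod>i=1..N. q i)) (N + n) = frac (real (\<Prod>i<n. q (Suc (N + i))) * x)"
proof -
  define A B where "A = (\<Prod>i=1..N. q i)" and "B = (\<Prod>i<n. q (Suc (N + i)))"
  have prod: "(\<Prod>i=1..N + n. q i) = A * B"
    unfolding A_def B_def by (induction n) (simp_all add: mult_ac)
  have "0 < A" unfolding A_def using assms by (rule prod_basic_sequence_pos)
  then show ?thesis
    unfolding cantor_orbit_def cantor_T_def prod A_def[symmetric] B_def[symmetric] by simp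
qed

lemma digit_block_exists:
  fixes a b w :: real and r :: nat
  assumes "0 \<le> a" "a + w \<le> b" "4 \<le> w * real r"
  shows "\<exists>d m. a * real r \<le> real d \<and> real d + real m \<le> b * real r \<and> w / 2 * real r \<le> real m"
proof (intro exI conjI)
  have "0 \<le> a * real r" "(a + w) * real r \<le> b * real r"
    using assms by (simp_all add: mult_right_mono)
  then show "real (nat \<lceil>a * real r\<rceil>) + real (nat \<lceil>w / 2 * real r\<rceil>) \<le> b * real r"
    using assms(3) by (simp add: distrib_right) linarith
qed linarith+

lemma digit_blocks_in_intervals_exist:
  assumes q: "infinite_in_limit q"
    and \<delta>: "0 < \<delta>" "\<And>n. \<delta> \<le> a n" "\<And>n. a n + \<delta> \<le> b n" "\<And>n. b n \<le> 1 - \<delta>"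
  obtains N d m where "digit_blocks (\<lambda>n. q (Suc (N + n))) d m \<delta> (\<delta> / 2)"
    "\<And>n. a (N + n) \<le> real (d n) / real (q (Suc (N + n)))"
    "\<And>n. (real (d n) + real (m n)) / real (q (Suc (N + n))) \<le> b (N + n)"
proof -
  have "filterlim (\<lambda>n. \<delta> * real (q n)) at_top sequentially"
    using q \<delta>(1) unfolding infinite_in_limit_def
    by (intro filterlim_tendsto_pos_mult_at_top[OF tendsto_const]
        filterlim_compose[OF filterlim_real_sequentially])
  then have "\<forall>\<^sub>F n in sequentially. 4 \<le> \<delta> * real (q n)" by (auto simp: filterlim_at_top)
  then obtain N where N: "\<And>n. N \<le> n \<Longrightarrow> 4 \<le> \<delta> * real (q n)"
    by (auto simp: eventually_sequentially)
  define r where "r n = q (Suc (N + n))" for n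
  have r_pos: "0 < r n" for n using N[of "Suc (N + n)"] by (auto simp: r_def intro: gr0I)
  have "\<exists>d m. a (N + n) * real (r n) \<le> real d \<and> real d + real m \<le> b (N + n) * real (r n) \<and>
      \<delta> / 2 * real (r n) \<le> real m" for n
    using \<delta>(1) \<delta>(2,3)[of "N + n"] N unfolding r_def
    by (intro digit_block_exists) auto
  then obtain d m where blocks: "\<And>n. a (N + n) * real (r n) \<le> real (d n)"
    "\<And>n. real (d n) + real (m n) \<le> b (N + n) * real (r n)" "\<And>n. \<delta> / 2 * real (r n) \<le> real (m n)"
    by metis
  have "digit_blocks r d m \<delta> (\<delta> / 2)"
  proof
    have "filterlim (\<lambda>n. Suc (N + n)) sequentially sequentially"
      by (simp add: filterlim_subseq strict_mono_def)
    with q show "filterlim r at_top sequentially"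
      unfolding r_def infinite_in_limit_def by (rule filterlim_compose)
    fix n
    show "\<delta> * real (r n) \<le> real (d n)"
      using mult_right_mono[OF \<delta>(2)] blocks(1) by (rule order_trans) simp
    show "real (d n) + real (m n) \<le> (1 - \<delta>) * real (r n)"
      using blocks(2) mult_right_mono[OF \<delta>(4)] by (rule order_trans) simp
  qed (use \<delta>(1) blocks(3) r_pos in auto)
  moreover have "a (N + n) \<le> real (d n) / real (r n)"
    "(real (d n) + real (m n)) / real (r n) \<le> b (N + n)" for n
    using blocks(1,2)[of n] r_pos[of n] by (simp_all add: pos_le_divide_eq pos_divide_le_eq)
  ultimately show ?thesis using that unfolding r_def by blast
qed

lemma hausdorff_measure_orbit_in_intervals_nonzero:
  assumes q: "basic_sequence q" "infinite_in_limit q"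
    and \<delta>: "0 < \<delta>" "\<And>n. \<delta> \<le> a n" "\<And>n. a n + \<delta> \<le> b n" "\<And>n. b n \<le> 1 - \<delta>"
    and s: "0 < s" "s < 1"
  shows "hausdorff_measure s
    {x \<in> {0..<1}. \<forall>\<^sub>F n in sequentially. cantor_orbit q x n \<in> {a n..b n}} \<noteq> 0"
    (is "hausdorff_measure s ?S \<noteq> 0")
proof
  assume null: "hausdorff_measure s ?S = 0"
  obtain N d m where "digit_blocks (\<lambda>n. q (Suc (N + n))) d m \<delta> (\<delta> / 2)"
    and blocks: "\<And>n. a (N + n) \<le> real (d n) / real (q (Suc (N + n)))"
      "\<And>n. (real (d n) + real (m n)) / real (q (Suc (N + n))) \<le> b (N + n)"
    using digit_blocks_in_intervals_exist[where a = a and b = b, OF q(2) \<delta>] by blast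
  then interpret digit_blocks "\<lambda>n. q (Suc (N + n))" d m \<delta> "\<delta> / 2" by simp
  \<comment> \<open>Dividing by \<open>P\<close> prepends \<open>N\<close> zero digits.\<close>
  define P where "P = real (\<Prod>i=1..N. q i)"
  have P: "1 \<le> P" using prod_basic_sequence_pos[OF q(1), of N] unfolding P_def by linarith
  define x where "x D = shifted_tail D 0 / P" for D
  have "x D \<in> ?S" if D: "D \<in> digit_sequences m" for D
  proof -
    have "cantor_orbit q (x D) (N + n) = shifted_tail D n" for n
      using frac_prod_times_cantor_tail[OF shifted_digits[OF D], of n]
        shifted_tail_in_Icc[OF D, of n] \<delta>(1)
      unfolding x_def P_def cantor_orbit_div_prod[OF q(1)] by (simp add: shifted_tail_def)
    then have "cantor_orbit q (x D) (N + n) \<in> {a (N + n)..b (N + n)}" for n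
      using shifted_tail_in_block[OF D, of n] blocks[of n] by auto
    then have "\<forall>n\<ge>N. cantor_orbit q (x D) n \<in> {a n..b n}" by (metis le_Suc_ex)
    moreover have "x D \<in> {0..<1}" using shifted_tail_in_Icc[OF D, of 0] \<delta>(1) P by (auto simp: x_def)
    ultimately show ?thesis by (auto simp: eventually_sequentially)
  qed
  then have "hausdorff_measure s (x ` digit_sequences m) \<le> hausdorff_measure s ?S"
    by (intro hausdorff_measure_mono) auto
  moreover have "hausdorff_measure s ((\<lambda>D. shifted_tail D 0) ` digit_sequences m)
      \<le> ennreal (P powr s) * hausdorff_measure (1 * s) (x ` digit_sequences m)"
    using P s by (intro hausdorff_measure_le_of_Hoelder)
      (auto simp: x_def dist_real_def diff_divide_distrib[symmetric])
  ultimately show False using hausdorff_measure_shifted_points_nonzero[OF s] null by simp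
qed

lemma interior_contains_Icc:
  fixes S :: "real set"
  assumes "interior (S \<inter> {0..1}) \<noteq> {}"
  shows "\<exists>a b. 0 < a \<and> a < b \<and> b < 1 \<and> {a..b} \<subseteq> S"
proof -
  obtain x e where "0 < e" "cball x e \<subseteq> interior (S \<inter> {0..1})"
    using assms open_interior by (meson ex_in_conv open_contains_cball)
  then have Icc: "{x..x + e} \<subseteq> interior S \<inter> {0<..<1}"
    by (auto simp: cball_eq_atLeastAtMost interior_Int)
  moreover have "x \<in> {x..x + e}" "x + e \<in> {x..x + e}" using \<open>0 < e\<close> by auto
  ultimately have "x \<in> {0<..<1}" "x + e \<in> {0<..<1}" "{x..x + e} \<subseteq> S"
    using interior_subset[of S] by blast+
  then show ?thesis using \<open>0 < e\<close> by (intro exI[of _ x] exI[of _ "x + e"]) auto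
qed

lemma hausdorff_dim_prescribed_orbit:
  assumes q: "basic_sequence q" "infinite_in_limit q"
    and K: "finite (range K)" "\<And>n. interior (K n \<inter> {0..1}) \<noteq> {}"
  shows "hausdorff_dim {x \<in> {0..<1}. \<forall>\<^sub>F n in sequentially. cantor_orbit q x n \<in> K n} = 1"
    (is "hausdorff_dim ?S = 1")
proof (rule antisym)
  show "hausdorff_dim ?S \<le> 1" by (rule hausdorff_dim_subset_unit_interval_le_1) auto
  have "\<forall>S\<in>range K. \<exists>a b. 0 < a \<and> a < b \<and> b < 1 \<and> {a..b} \<subseteq> S"
    using K(2) interior_contains_Icc by blast
  then obtain a b where intervals:
    "\<And>n. 0 < a (K n) \<and> a (K n) < b (K n) \<and> b (K n) < 1 \<and> {a (K n)..b (K n)} \<subseteq> K n"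
    using rangeI by metis
  define \<delta> where "\<delta> = Min ((\<lambda>S. min (a S) (min (b S - a S) (1 - b S))) ` range K)"
  have \<delta>_pos: "0 < \<delta>" unfolding \<delta>_def using K(1) intervals by (subst Min_gr_iff) auto
  have \<delta>_le: "\<delta> \<le> min (a (K n)) (min (b (K n) - a (K n)) (1 - b (K n)))" for n
    unfolding \<delta>_def using K(1) by (intro Min_le) auto
  have "hausdorff_measure s ?S \<noteq> 0" if s: "0 < s" "s < 1" for s
  proof -
    let ?S' = "{x \<in> {0..<1}. \<forall>\<^sub>F n in sequentially. cantor_orbit q x n \<in> {a (K n)..b (K n)}}"
    have "hausdorff_measure s ?S' \<noteq> 0"
    proof (rule hausdorff_measure_orbit_in_intervals_nonzero[OF q \<delta>_pos])
      show "\<delta> \<le> a (K n)" "a (K n) + \<delta> \<le> b (K n)" "b (K n) \<le> 1 - \<delta>" for n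
        using \<delta>_le[of n] by auto
    qed (use s in auto)
    moreover have "y \<in> K n" if "y \<in> {a (K n)..b (K n)}" for y n using intervals that by blast
    then have "?S' \<subseteq> ?S" by (auto elim!: eventually_mono)
    ultimately show ?thesis using hausdorff_measure_mono[of ?S' ?S s] by auto
  qed
  then have "ennreal 1 \<le> hausdorff_dim ?S" by (intro le_hausdorff_dimI) auto
  then show "1 \<le> hausdorff_dim ?S" by simp
qed

section \<open>Visit frequencies\<close>

definition floor_jump :: "real \<Rightarrow> real \<Rightarrow> nat \<Rightarrow> bool" where
  "floor_jump p \<theta> i \<longleftrightarrow> \<lfloor>real i * p + \<theta>\<rfloor> < \<lfloor>real (Suc i) * p + \<theta>\<rfloor>"

lemma floor_jump_iff: "floor_jump p \<theta> i \<longleftrightarrow> \<lfloor>real i * p + \<theta>\<rfloor> < \<lfloor>real i * p + \<theta> + p\<rfloor>"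
proof -
  have "real (Suc i) * p + \<theta> = real i * p + \<theta> + p" by (simp add: distrib_right)
  then show ?thesis by (simp only: floor_jump_def)
qed

lemma floor_Suc_times:
  fixes p \<theta> :: real
  assumes "0 \<le> p" "p \<le> 1"
  shows "\<lfloor>real (Suc i) * p + \<theta>\<rfloor> = \<lfloor>real i * p + \<theta>\<rfloor> + (if floor_jump p \<theta> i then 1 else 0)"
proof -
  have "real (Suc i) * p + \<theta> = (real i * p + \<theta>) + p" by (simp add: distrib_right)
  then show ?thesis unfolding floor_jump_iff using assms by (simp del: of_nat_Suc) linarith
qed

lemma card_floor_jumps:
  assumes p: "0 \<le> p" "p \<le> 1"
  shows "int (card {i. i \<le> n \<and> floor_jump p \<theta> i}) = \<lfloor>real (Suc n) * p + \<theta>\<rfloor> - \<lfloor>\<theta>\<rfloor>"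
proof (induction n)
  case 0
  have "{i. i \<le> 0 \<and> floor_jump p \<theta> i} = (if floor_jump p \<theta> 0 then {0} else {})" by auto
  then show ?case using floor_Suc_times[OF p, of 0 \<theta>] by simp
next
  case (Suc n)
  have "{i. i \<le> Suc n \<and> floor_jump p \<theta> i} = (if floor_jump p \<theta> (Suc n)
      then insert (Suc n) {i. i \<le> n \<and> floor_jump p \<theta> i} else {i. i \<le> n \<and> floor_jump p \<theta> i})"
    by (auto simp: le_Suc_eq)
  then show ?case using Suc floor_Suc_times[OF p, of "Suc n" \<theta>] by simp
qed

lemma tendsto_over_n_of_bounded_discrepancy:
  fixes u :: "nat \<Rightarrow> real"
  assumes "\<And>n. \<bar>u n - real n * p\<bar> \<le> B"
  shows "(\<lambda>n. u n / real n) \<longlonglongrightarrow> p"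
proof (rule LIM_zero_cancel, rule Lim_null_comparison)
  show "(\<lambda>n. B / real n) \<longlonglongrightarrow> 0" by (rule lim_const_over_n)
  show "\<forall>\<^sub>F n in sequentially. norm (u n / real n - p) \<le> B / real n"
    using eventually_gt_at_top[of 0]
  proof eventually_elim
    case (elim n)
    then have "u n / real n - p = (u n - real n * p) / real n" by (simp add: field_simps)
    then show ?case using assms[of n] by (simp add: divide_right_mono)
  qed
qed

lemma visits_bounded_discrepancy:
  assumes "\<forall>\<^sub>F i in sequentially. \<omega> i \<in> I \<longleftrightarrow> Q i"
  obtains N where "\<And>n. \<bar>real (visits n I \<omega>) - real (card {i. i \<le> n \<and> Q i})\<bar> \<le> real N"
proof -
  obtain N where N: "\<And>i. N \<le> i \<Longrightarrow> \<omega> i \<in> I \<longleftrightarrow> Q i"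
    using assms by (auto simp: eventually_sequentially)
  have "card {i. i \<le> n \<and> R i} \<le> card {i. i \<le> n \<and> R' i} + N"
    if "\<And>i. N \<le> i \<Longrightarrow> R i \<longleftrightarrow> R' i" for n and R R' :: "nat \<Rightarrow> bool"
  proof -
    have "{i. i \<le> n \<and> R i} \<subseteq> {i. i \<le> n \<and> R' i} \<union> {..<N}"
      using that by (auto simp: not_le[symmetric])
    then have "card {i. i \<le> n \<and> R i} \<le> card ({i. i \<le> n \<and> R' i} \<union> {..<N})"
      by (intro card_mono) auto
    also have "\<dots> \<le> card {i. i \<le> n \<and> R' i} + N"
      using card_Un_le[of "{i. i \<le> n \<and> R' i}" "{..<N}"] by simp
    finally show ?thesis .
  qed
  then have "visits n I \<omega> \<le> card {i. i \<le> n \<and> Q i} + N"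
    "card {i. i \<le> n \<and> Q i} \<le> visits n I \<omega> + N" for n
    unfolding visits_def using N by simp_all
  then have "\<bar>real (visits n I \<omega>) - real (card {i. i \<le> n \<and> Q i})\<bar> \<le> real N" for n
    by (simp add: abs_le_iff diff_le_eq flip: of_nat_add) (simp add: add.commute)
  then show ?thesis by (rule that)
qed

lemma visits_frequency_floor_jump:
  assumes p: "0 \<le> p" "p \<le> 1"
    and visits: "\<forall>\<^sub>F i in sequentially. \<omega> i \<in> I \<longleftrightarrow> floor_jump p \<theta> i"
  shows "(\<lambda>n. real (visits n I \<omega>) / real n) \<longlonglongrightarrow> p"
proof -
  obtain N where N:
    "\<And>n. \<bar>real (visits n I \<omega>) - real (card {i. i \<le> n \<and> floor_jump p \<theta> i})\<bar> \<le> real N"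
    using visits_bounded_discrepancy[OF visits] by blast
  have "\<bar>real (visits n I \<omega>) - real n * p\<bar> \<le> real N + 3" for n
  proof -
    have "real (card {i. i \<le> n \<and> floor_jump p \<theta> i}) = of_int (\<lfloor>real (Suc n) * p + \<theta>\<rfloor> - \<lfloor>\<theta>\<rfloor>)"
      by (metis card_floor_jumps[OF p] of_int_of_nat_eq)
    moreover have "real (Suc n) * p = real n * p + p" by (simp add: distrib_right)
    ultimately have "\<bar>real (card {i. i \<le> n \<and> floor_jump p \<theta> i}) - real n * p\<bar> \<le> 3"
      using p by linarith
    then show ?thesis using N[of n] by linarith
  qed
  then show ?thesis by (rule tendsto_over_n_of_bounded_discrepancy)
qed

text \<open>Otherwise a half-open interval of length \<open>p\<close> contains both an integer and a half-integer,
  but these differ by at least \<open>1/2\<close>.\<close>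

lemma floor_jumps_disjoint:
  assumes "p \<le> 1/2" "floor_jump p \<theta> i"
  shows "\<not> floor_jump p (\<theta> + 1/2) i"
proof
  assume half: "floor_jump p (\<theta> + 1/2) i"
  define x where "x = real i * p + \<theta>"
  define y z where "y = \<lfloor>x + p\<rfloor>" and "z = \<lfloor>x + 1/2 + p\<rfloor>"
  have "\<lfloor>x\<rfloor> < y" using assms(2) by (simp only: floor_jump_iff x_def y_def)
  then have "x < of_int y" "of_int y \<le> x + p" unfolding y_def by linarith+
  moreover have "\<lfloor>x + 1/2\<rfloor> < z"
    using half by (simp only: floor_jump_iff x_def z_def add.assoc)
  then have "x + 1/2 < of_int z" "of_int z \<le> x + 1/2 + p" unfolding z_def by linarith+
  ultimately have "real_of_int y < real_of_int z" "real_of_int z < real_of_int (y + 1)"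
    using assms(1) by (linarith, simp)
  then show False unfolding of_int_less_iff by simp
qed

section \<open>Intervals\<close>

lemma interior_nondegenerate_interval:
  assumes "nondegenerate_interval I"
  shows "interior I \<noteq> {}"
proof -
  obtain u v where "u \<in> I" "v \<in> I" "u < v" "is_interval I"
    using assms by (auto simp: nondegenerate_interval_def)
  then have "{u<..<v} \<subseteq> I"
    by (meson greaterThanLessThan_iff less_imp_le mem_is_interval_1_I subsetI)
  then have "{u<..<v} \<subseteq> interior I" by (intro interior_maximal open_greaterThanLessThan)
  moreover have "{u<..<v} \<noteq> {}" using \<open>u < v\<close> by simp
  ultimately show ?thesis by blast
qed

lemma interior_Diff_nonempty_of_measure_less:
  fixes S G :: "'a::euclidean_space set"
  assumes G: "open G" "G \<in> lmeasurable" and S: "bounded S" "negligible (frontier S)"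
    and less: "measure lebesgue S < measure lebesgue G"
  shows "interior (G - S) \<noteq> {}"
proof
  assume "interior (G - S) = {}"
  moreover have "G - closure S \<subseteq> interior (G - S)"
    using G(1) closure_subset[of S] by (intro interior_maximal open_Diff) auto
  ultimately have "G \<subseteq> closure S" by auto
  then have "measure lebesgue G \<le> measure lebesgue (closure S)"
    using G(2) S(1) by (intro measure_mono_fmeasurable)
      (auto intro: lmeasurable_compact simp: compact_closure)
  then show False using less measure_closure[OF S] by simp
qed

lemma interior_complement_of_intervals_nonempty:
  fixes I J :: "real set"
  assumes I: "is_interval I" "I \<subseteq> {0..1}" and J: "is_interval J" "J \<subseteq> {0..1}"
    and less: "measure lebesgue I + measure lebesgue J < 1"
  shows "interior ({0..1} - (I \<union> J)) \<noteq> {}"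
proof -
  have bounded: "bounded I" "bounded J" using I J bounded_closed_interval bounded_subset by blast+
  have "negligible (frontier I \<union> frontier J)"
    using I(1) J(1) by (intro negligible_Un negligible_convex_frontier is_interval_convex)
  then have "negligible (frontier (I \<union> J))"
    by (rule negligible_subset) (rule frontier_Un_subset)
  moreover have "measure lebesgue (I \<union> J) \<le> measure lebesgue I + measure lebesgue J"
    using I(1) J(1) bounded
    by (intro measure_Un_le fmeasurableD measurable_convex is_interval_convex)
  ultimately have "interior ({0<..<1} - (I \<union> J)) \<noteq> {}"
    using bounded less by (intro interior_Diff_nonempty_of_measure_less) auto
  moreover have "interior ({0<..<1} - (I \<union> J)) \<subseteq> interior ({0..1} - (I \<union> J))"
    by (rule interior_mono) auto
  ultimately show ?thesis by blast
qed

section \<open>Two equal frequencies\<close>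

definition visit_target :: "real \<Rightarrow> real set \<Rightarrow> real set \<Rightarrow> nat \<Rightarrow> real set" where
  "visit_target p I J n =
    (if floor_jump p 0 n then I else if floor_jump p (1/2) n then J else - (I \<union> J))"

lemma finite_range_visit_target: "finite (range (visit_target p I J))"
  by (rule finite_subset[of _ "{I, J, - (I \<union> J)}"]) (auto simp: visit_target_def)

lemma interior_visit_target_nonempty:
  assumes I: "nondegenerate_interval I" "I \<subseteq> {0..1}" and J: "nondegenerate_interval J" "J \<subseteq> {0..1}"
    and less: "measure lebesgue I + measure lebesgue J < 1"
  shows "interior (visit_target p I J n \<inter> {0..1}) \<noteq> {}"
proof -
  have "interior (I \<inter> {0..1}) \<noteq> {}" "interior (J \<inter> {0..1}) \<noteq> {}"
    using interior_nondegenerate_interval I J by (simp_all add: Int_absorb2)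
  moreover have "interior (- (I \<union> J) \<inter> {0..1}) \<noteq> {}"
    using interior_complement_of_intervals_nonempty[of I J] I J less
    by (simp add: nondegenerate_interval_def Diff_eq Int_commute)
  ultimately show ?thesis by (simp add: visit_target_def)
qed

lemma
  assumes p: "0 \<le> p" "p \<le> 1/2" and disjoint: "I \<inter> J = {}"
    and visits: "\<forall>\<^sub>F n in sequentially. \<omega> n \<in> visit_target p I J n"
  shows visit_target_frequency_fst: "(\<lambda>n. real (visits n I \<omega>) / real n) \<longlonglongrightarrow> p"
    and visit_target_frequency_snd: "(\<lambda>n. real (visits n J \<omega>) / real n) \<longlonglongrightarrow> p"
proof -
  have "(y \<in> I \<longleftrightarrow> floor_jump p 0 n) \<and> (y \<in> J \<longleftrightarrow> floor_jump p (1/2) n)"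
    if "y \<in> visit_target p I J n" for y n
    using that disjoint floor_jumps_disjoint[OF p(2), of 0 n]
    by (auto simp: visit_target_def split: if_splits)
  with visits have "\<forall>\<^sub>F n in sequentially. \<omega> n \<in> I \<longleftrightarrow> floor_jump p 0 n"
    "\<forall>\<^sub>F n in sequentially. \<omega> n \<in> J \<longleftrightarrow> floor_jump p (1/2) n"
    by (auto elim!: eventually_mono)
  then show "(\<lambda>n. real (visits n I \<omega>) / real n) \<longlonglongrightarrow> p" "(\<lambda>n. real (visits n J \<omega>) / real n) \<longlonglongrightarrow> p"
    using p by (auto intro!: visits_frequency_floor_jump)
qed

theorem mainTheorem4:
  fixes I J :: "real set" and f g :: "real \<Rightarrow> real" and q :: "nat \<Rightarrow> nat"
  assumes "nondegenerate_interval I" and "I \<subseteq> {0..1}"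
    and "nondegenerate_interval J" and "J \<subseteq> {0..1}"
    and "I \<inter> J = {}"
    and "\<exists>x0\<in>{0..1/2}. f x0 = g x0"
    and "measure lebesgue I + measure lebesgue J < 1"
    and "basic_sequence q" and "infinite_in_limit q"
  shows "hausdorff_dim {x \<in> {0..<1}.
           convergent (\<lambda>n. real (visits n I (cantor_orbit q x)) / real n) \<and>
           convergent (\<lambda>n. real (visits n J (cantor_orbit q x)) / real n) \<and>
           f (lim (\<lambda>n. real (visits n I (cantor_orbit q x)) / real n)) =
           g (lim (\<lambda>n. real (visits n J (cantor_orbit q x)) / real n))} = 1"
    (is "hausdorff_dim ?E = 1")
proof (rule antisym)
  show "hausdorff_dim ?E \<le> 1" by (rule hausdorff_dim_subset_unit_interval_le_1) blast
  obtain p where p: "0 \<le> p" "p \<le> 1/2" "f p = g p" using assms(6) by auto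
  let ?S = "{x \<in> {0..<1}. \<forall>\<^sub>F n in sequentially. cantor_orbit q x n \<in> visit_target p I J n}"
  have "hausdorff_dim ?S = 1"
    using finite_range_visit_target interior_visit_target_nonempty[OF assms(1-4,7)]
    by (rule hausdorff_dim_prescribed_orbit[OF assms(8,9)])
  moreover have "?S \<subseteq> ?E"
  proof
    fix x assume x: "x \<in> ?S"
    then have visits: "\<forall>\<^sub>F n in sequentially. cantor_orbit q x n \<in> visit_target p I J n" by simp
    note frequencies = visit_target_frequency_fst[OF p(1,2) assms(5) visits]
      visit_target_frequency_snd[OF p(1,2) assms(5) visits]
    from x p(3) show "x \<in> ?E"
      using frequencies frequencies[THEN limI] by (auto intro: convergentI)
  qed
  ultimately show "1 \<le> hausdorff_dim ?E" using hausdorff_dim_mono[of ?S ?E] by simp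
qed

end
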